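(* Let $n\in\mathbb N$. If $S\subset M_n$ is an operator system, then $\mathcal M(S)=\pi_{S_{\rm h}}(\mathcal M_n)$.
   Context: $M_n$ is the algebra of complex $n$-by-$n$ matrices with identity $\mathbb 1$ and Hilbert-Schmidt inner product $\langle a,b\rangle=\operatorname{tr}(a^*b)$. $(M_n)_{\rm h}$ is the real space of hermitian matrices, on which the Hilbert-Schmidt inner product restricts to a Euclidean scalar product. $\mathcal M_n$ is the set of density matrices, i.e. positive-semidefinite hermitian matrices in $M_n$ of trace one. An operator system $S\subset M_n$ is a complex vector subspace which contains $\mathbb 1$ and is self-adjoint ($s\in S$ implies $s^*\in S$); $S_{\rm h}$ is the real space of hermitian matrices in $S$. For $a\in S$ define $f_a:S\to\mathbb C$, $f_a(s)=\langle a,s\rangle$. A state on $S$ is a complex linear functional $f:S\to\mathbb C$ which is positive ($f(s)\ge0$ for all positive-semidefinite $s\in S$) and normalized ($f(\mathbb 1)=1$). The state space of $S$ is $\mathcal M(S):=\{s\in S\mid f_s\text{ is a state on }S\}$. For a real subspace $X\subset(M_n)_{\rm h}$, $\pi_X:(M_n)_{\rm h}\to X$ denotes the orthogonal projection onto $X$. *)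

theory Defs
  imports "HOL-Analysis.Analysis"
begin

type_synonym 'n cmat = "complex ^ 'n ^ 'n"

text \<open>
  The library's \<open>*s\<close> on \<open>complex ^ 'n ^ 'n\<close> would take scalars from \<open>complex ^ 'n\<close>,
  so multiplication of a matrix by a complex number is introduced here.
\<close>

definition cscale :: "complex \<Rightarrow> 'n::finite cmat \<Rightarrow> 'n cmat" where
  "cscale c a = (\<chi> i j. c * a $ i $ j)"

global_interpretation cmat: vector_space "cscale :: complex \<Rightarrow> 'n::finite cmat \<Rightarrow> 'n cmat"
  by unfold_locales (simp_all add: cscale_def vec_eq_iff algebra_simps)

definition conj_transpose :: "'n::finite cmat \<Rightarrow> 'n cmat" where
  "conj_transpose a = (\<chi> i j. cnj (a $ j $ i))"

definition hermitian :: "'n::finite cmat \<Rightarrow> bool" where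
  "hermitian a \<longleftrightarrow> conj_transpose a = a"

definition hs_inner :: "'n::finite cmat \<Rightarrow> 'n cmat \<Rightarrow> complex" where
  "hs_inner a b = trace (conj_transpose a ** b)"

definition pos_semidef :: "'n::finite cmat \<Rightarrow> bool" where
  "pos_semidef a \<longleftrightarrow> hermitian a \<and>
     (\<forall>x :: complex ^ 'n. (\<Sum>i\<in>UNIV. cnj (x $ i) * (a *v x) $ i) \<in> \<real>\<^sub>\<ge>\<^sub>0)"

definition density_matrices :: "'n::finite cmat set" where
  "density_matrices = {a. pos_semidef a \<and> trace a = 1}"

definition operator_system :: "'n::finite cmat set \<Rightarrow> bool" where
  "operator_system S \<longleftrightarrow>
     cmat.subspace S \<and> mat 1 \<in> S \<and> (\<forall>s\<in>S. conj_transpose s \<in> S)"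

definition hermitian_part :: "'n::finite cmat set \<Rightarrow> 'n cmat set" where
  "hermitian_part S = {s \<in> S. hermitian s}"

text \<open>
  A functional on \<open>S\<close> is represented by a total function of which only the values
  on \<open>S\<close> are constrained.
\<close>

definition state_on :: "'n::finite cmat set \<Rightarrow> ('n cmat \<Rightarrow> complex) \<Rightarrow> bool" where
  "state_on S f \<longleftrightarrow>
     (\<forall>s\<in>S. \<forall>t\<in>S. f (s + t) = f s + f t) \<and>
     (\<forall>c. \<forall>s\<in>S. f (cscale c s) = c * f s) \<and>
     (\<forall>s\<in>S. pos_semidef s \<longrightarrow> f s \<in> \<real>\<^sub>\<ge>\<^sub>0) \<and>
     f (mat 1) = 1"

definition state_space :: "'n::finite cmat set \<Rightarrow> 'n cmat set" where
  "state_space S = {a \<in> S. state_on S (\<lambda>s. hs_inner a s)}"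

text \<open>
  Orthogonal projection onto a real subspace \<open>X\<close> of the hermitian matrices; it is
  only meaningful for such \<open>X\<close> and for hermitian arguments, where the description
  is unique by \<open>orth_proj_ex1\<close> below.
\<close>

definition orth_proj :: "'n::finite cmat set \<Rightarrow> 'n cmat \<Rightarrow> 'n cmat" where
  "orth_proj X a = (THE p. p \<in> X \<and> (\<forall>x\<in>X. hs_inner x (a - p) = 0))"

lemma hs_inner_eq_sum:
  "hs_inner a b = (\<Sum>i\<in>UNIV. \<Sum>j\<in>UNIV. cnj (a $ i $ j) * b $ i $ j)"
  unfolding hs_inner_def trace_def matrix_matrix_mult_def conj_transpose_def
  by (simp, rule sum.swap)

lemma Re_hs_inner: "Re (hs_inner a b) = a \<bullet> b"
  by (simp add: hs_inner_eq_sum inner_vec_def inner_complex_def)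

lemma hermitian_nth: "hermitian a \<Longrightarrow> cnj (a $ i $ j) = a $ j $ i"
  by (auto simp: hermitian_def conj_transpose_def vec_eq_iff)

lemma hs_inner_hermitian:
  assumes "hermitian a" "hermitian b"
  shows "hs_inner a b = complex_of_real (a \<bullet> b)"
proof -
  have "cnj (hs_inner a b) = (\<Sum>i\<in>UNIV. \<Sum>j\<in>UNIV. cnj (a $ j $ i) * b $ j $ i)"
    using assms by (simp add: hs_inner_eq_sum hermitian_nth)
  also have "\<dots> = hs_inner a b"
    unfolding hs_inner_eq_sum by (rule sum.swap)
  finally show ?thesis
    by (metis Re_hs_inner Reals_cnj_iff of_real_Re)
qed

lemma hermitian_diff: "hermitian a \<Longrightarrow> hermitian b \<Longrightarrow> hermitian (a - b)"
  by (auto simp: hermitian_def conj_transpose_def vec_eq_iff)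

lemma orth_proj_ex1:
  assumes X: "subspace X" "X \<subseteq> Collect hermitian" and a: "hermitian a"
  shows "\<exists>!p. p \<in> X \<and> (\<forall>x\<in>X. hs_inner x (a - p) = 0)"
proof -
  have eq: "hs_inner x (a - p) = 0 \<longleftrightarrow> x \<bullet> (a - p) = 0" if "x \<in> X" "p \<in> X" for x p
    using that X a by (subst hs_inner_hermitian) (auto intro: hermitian_diff)
  obtain y z where yz: "y \<in> span X" "\<And>w. w \<in> span X \<Longrightarrow> orthogonal z w" "a = y + z"
    using orthogonal_subspace_decomp_exists by blast
  have sp: "span X = X" using X(1) by (simp only: span_eq_iff)
  have y: "y \<in> X" and z: "\<And>x. x \<in> X \<Longrightarrow> x \<bullet> (a - y) = 0"
    using yz unfolding sp by (auto simp: orthogonal_def inner_commute)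
  have "y \<in> X \<and> (\<forall>x\<in>X. hs_inner x (a - y) = 0)"
    using y z eq by blast
  moreover have "p = q"
    if p: "p \<in> X" "\<forall>x\<in>X. hs_inner x (a - p) = 0"
      and q: "q \<in> X" "\<forall>x\<in>X. hs_inner x (a - q) = 0" for p q
  proof -
    have d: "p - q \<in> X" using X p q by (simp add: subspace_diff)
    have "(p - q) \<bullet> (a - p) = 0" "(p - q) \<bullet> (a - q) = 0"
      using eq d p q by auto
    then have "(p - q) \<bullet> (p - q) = 0"
      by (simp add: inner_diff_right)
    then show ?thesis by simp
  qed
  ultimately show ?thesis by blast
qed

end

theory Submission
  imports Defs
begin

text \<open>
  Write \<open>X\<close> for the real space of hermitian elements of \<open>S\<close>.

  The projection of a density matrix \<open>\<rho>\<close> induces on \<open>X\<close> the same functional as \<open>\<rho>\<close> itself,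
  and \<open>\<rho>\<close> is nonnegative on positive-semidefinite matrices because the positive-semidefinite
  cone pairs nonnegatively with itself (\<open>inner_pos_semidef_nonneg\<close>). Hence projections of density
  matrices lie in the state space.

  Conversely, let \<open>f\<^sub>a\<close> be a state. Positivity forces \<open>a\<close> to be hermitian
  (\<open>hermitian_if_state\<close>), so \<open>a \<in> X\<close>. The matrices that project to the same points as density
  matrices form the sum \<open>C\<close> of the compact convex set of density matrices and the orthogonal
  complement of \<open>X\<close>, a closed convex set. If \<open>a \<notin> C\<close>, some hyperplane with normal \<open>h\<close> strictly
  separates \<open>a\<close> from \<open>C\<close>, say \<open>h \<bullet> a < b < h \<bullet> c\<close> for \<open>c \<in> C\<close>. Since \<open>C\<close> is invariant under the
  complement of \<open>X\<close>, the normal \<open>h\<close> lies in \<open>X\<close>. The bound on the pure states \<open>xx\<^sup>*\<close> says that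
  \<open>h - b\<one>\<close> is positive semidefinite, but \<open>f\<^sub>a\<close> is negative on it, which contradicts positivity
  of the state.
\<close>

section \<open>Adjoint, scaling and Hilbert-Schmidt product\<close>

lemma conj_transpose_nth [simp]: "conj_transpose a $ i $ j = cnj (a $ j $ i)"
  by (simp add: conj_transpose_def)

lemma hermitian_iff: "hermitian a \<longleftrightarrow> (\<forall>i j. cnj (a $ i $ j) = a $ j $ i)"
  by (auto simp: hermitian_def vec_eq_iff)

lemma hermitian_add: "hermitian a \<Longrightarrow> hermitian b \<Longrightarrow> hermitian (a + b)"
  by (simp add: hermitian_iff)

lemma hermitian_scaleR: "hermitian a \<Longrightarrow> hermitian (r *\<^sub>R a)"
  by (simp add: hermitian_iff)

lemma hermitian_mat_1: "hermitian (mat 1)"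
  by (simp add: hermitian_iff mat_def)

lemma cscale_of_real: "cscale (of_real r) a = r *\<^sub>R a"
  by (simp add: cscale_def vec_eq_iff scaleR_conv_of_real[where 'a=complex])

lemma hs_inner_add_right: "hs_inner a (s + t) = hs_inner a s + hs_inner a t"
  by (simp add: hs_inner_eq_sum algebra_simps sum.distrib)

lemma hs_inner_cscale_right: "hs_inner a (cscale c s) = c * hs_inner a s"
  by (simp add: hs_inner_eq_sum cscale_def sum_distrib_left algebra_simps)

lemma inner_conj_transpose: "conj_transpose a \<bullet> conj_transpose b = a \<bullet> b"
proof -
  have "conj_transpose a \<bullet> conj_transpose b
      = (\<Sum>i\<in>UNIV. \<Sum>j\<in>UNIV. a $ j $ i \<bullet> b $ j $ i)"
    by (simp add: inner_vec_def inner_complex_def)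
  also have "\<dots> = a \<bullet> b"
    unfolding inner_vec_def by (rule sum.swap)
  finally show ?thesis .
qed

lemma hs_inner_mat_1: "hs_inner (mat 1) a = trace a"
proof -
  have "hs_inner (mat 1) a = (\<Sum>i\<in>UNIV. \<Sum>j\<in>UNIV. if i = j then a $ i $ j else 0)"
    unfolding hs_inner_eq_sum by (intro sum.cong refl) (simp add: mat_def)
  then show ?thesis
    by (simp add: trace_def)
qed

lemma trace_hermitian: "hermitian a \<Longrightarrow> trace a = of_real (mat 1 \<bullet> a)"
  by (metis hs_inner_mat_1 hs_inner_hermitian hermitian_mat_1)

section \<open>Rank-one matrices and positive-semidefiniteness\<close>

definition rank_one :: "complex ^ 'n \<Rightarrow> 'n::finite cmat" where
  "rank_one x = (\<chi> i j. x $ i * cnj (x $ j))"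

lemma hermitian_rank_one: "hermitian (rank_one x)"
  by (simp add: hermitian_iff rank_one_def)

text \<open>
  Quadratic forms are pairings with rank-one matrices; this reduces positivity to a family of
  linear inequalities.
\<close>

lemma quadratic_form_eq_hs_inner:
  "(\<Sum>i\<in>UNIV. cnj (x $ i) * (a *v x) $ i) = hs_inner (rank_one x) a"
  by (simp add: hs_inner_eq_sum rank_one_def matrix_vector_mult_def sum_distrib_left
      algebra_simps)

lemma pos_semidef_iff:
  "pos_semidef a \<longleftrightarrow> hermitian a \<and> (\<forall>x. 0 \<le> rank_one x \<bullet> a)"
  unfolding pos_semidef_def quadratic_form_eq_hs_inner
  by (auto simp: hs_inner_hermitian hermitian_rank_one)

lemma Re_quadratic_form: "rank_one x \<bullet> a = Re (\<Sum>i\<in>UNIV. cnj (x $ i) * (a *v x) $ i)"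
  by (simp only: quadratic_form_eq_hs_inner Re_hs_inner)

lemma inner_mat_1_rank_one: "mat 1 \<bullet> rank_one x = (norm x)\<^sup>2"
proof -
  have "mat 1 \<bullet> rank_one x = Re (trace (rank_one x))"
    by (simp only: hs_inner_mat_1 flip: Re_hs_inner)
  also have "\<dots> = x \<bullet> x"
    by (simp add: trace_def rank_one_def inner_vec_def inner_complex_def)
  finally show ?thesis
    by (simp add: power2_norm_eq_inner)
qed

lemma inner_rank_one_rank_one: "rank_one y \<bullet> rank_one x = (cmod (\<Sum>i\<in>UNIV. cnj (x $ i) * y $ i))\<^sup>2"
proof -
  let ?c = "\<Sum>i\<in>UNIV. cnj (x $ i) * y $ i"
  have "hs_inner (rank_one y) (rank_one x) = cnj ?c * ?c"
    unfolding hs_inner_eq_sum cnj_sum sum_product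
    by (simp add: rank_one_def algebra_simps)
  also have "\<dots> = of_real ((cmod ?c)\<^sup>2)"
    by (simp only: complex_norm_square mult.commute)
  finally show ?thesis
    by (simp flip: Re_hs_inner)
qed

lemma norm_rank_one: "norm (rank_one x) = (norm x)\<^sup>2"
proof -
  have "(\<Sum>i\<in>UNIV. cnj (x $ i) * x $ i) = of_real ((norm x)\<^sup>2)"
    by (simp add: power2_norm_eq_inner inner_vec_def complex_eq_iff inner_complex_def)
  then have "(norm (rank_one x))\<^sup>2 = ((norm x)\<^sup>2)\<^sup>2"
    unfolding power2_norm_eq_inner[of "rank_one x"] inner_rank_one_rank_one
    by (simp only: norm_of_real) simp
  then show ?thesis
    by (rule power2_eq_imp_eq) simp_all
qed

text \<open>
  The norm dominates the spectral radius: Cauchy-Schwarz bounds the quadratic form of \<open>h\<close> at \<open>x\<close>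
  by \<open>\<parallel>h\<parallel> \<parallel>xx\<^sup>*\<parallel> = \<parallel>h\<parallel> \<parallel>x\<parallel>\<^sup>2\<close>.
\<close>

lemma pos_semidef_add_norm:
  assumes "hermitian h"
  shows "pos_semidef (h + norm h *\<^sub>R mat 1)"
  unfolding pos_semidef_iff
proof (intro conjI allI)
  show "hermitian (h + norm h *\<^sub>R mat 1)"
    by (intro hermitian_add hermitian_scaleR hermitian_mat_1 assms)
  fix x
  have "\<bar>rank_one x \<bullet> h\<bar> \<le> (norm x)\<^sup>2 * norm h"
    using Cauchy_Schwarz_ineq2[of "rank_one x" h] by (simp add: norm_rank_one)
  moreover have "rank_one x \<bullet> mat 1 = (norm x)\<^sup>2"
    by (simp only: inner_mat_1_rank_one inner_commute)
  ultimately show "0 \<le> rank_one x \<bullet> (h + norm h *\<^sub>R mat 1)"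
    by (simp add: inner_add_right mult.commute)
qed

section \<open>Positive-semidefinite matrices pair nonnegatively\<close>

lemma matrix_vector_mult_axis: "((a :: 'n::finite cmat) *v axis k 1) $ i = a $ i $ k"
proof -
  have "(a *v axis k 1) $ i = (\<Sum>j\<in>UNIV. if j = k then a $ i $ j else 0)"
    unfolding matrix_vector_mult_def by (simp add: axis_def if_distrib cong: if_cong)
  then show ?thesis by simp
qed

lemma rank_one_axis: "rank_one (axis k 1) \<bullet> a = Re (a $ k $ k)"
proof -
  have "(\<Sum>i\<in>UNIV. cnj (axis k 1 $ i) * (a *v axis k 1) $ i)
      = (\<Sum>i\<in>UNIV. if i = k then a $ i $ k else 0)"
    by (intro sum.cong refl) (simp add: matrix_vector_mult_axis, simp add: axis_def)
  then show ?thesis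
    by (simp add: Re_quadratic_form)
qed

lemma pos_semidef_diagonal:
  assumes "pos_semidef a"
  shows "a $ k $ k = of_real (Re (a $ k $ k))" "0 \<le> Re (a $ k $ k)"
proof -
  have "cnj (a $ k $ k) = a $ k $ k"
    using assms by (simp add: pos_semidef_iff hermitian_iff)
  then show "a $ k $ k = of_real (Re (a $ k $ k))"
    by (simp add: complex_eq_iff)
  show "0 \<le> Re (a $ k $ k)"
    using assms by (metis pos_semidef_iff rank_one_axis)
qed

lemma pos_semidef_zero_diagonal:
  assumes a: "pos_semidef a" and zero: "\<And>k. a $ k $ k = 0"
  shows "a = 0"
proof -
  have "a $ i $ j = 0" for i j
  proof (cases "i = j")
    case False
    have ji: "a $ j $ i = cnj (a $ i $ j)"
      using a by (simp add: pos_semidef_iff hermitian_iff)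
    \<comment> \<open>The quadratic form takes the value \<open>- 2 \<bar>a\<^sub>i\<^sub>j\<bar>\<^sup>2\<close> at \<open>e\<^sub>i - cnj (a\<^sub>i\<^sub>j) e\<^sub>j\<close>.\<close>
    define x where "x = axis i 1 - cnj (a $ i $ j) *s axis j 1"
    have ax: "(a *v x) $ l = a $ l $ i - cnj (a $ i $ j) * a $ l $ j" for l
      by (simp add: x_def matrix_vector_mult_diff_distrib matrix_vector_mult_axis
          vector_scalar_commute)
    have "(\<Sum>l\<in>UNIV. cnj (x $ l) * (a *v x) $ l)
       = (\<Sum>l\<in>UNIV. (if l = i then (a *v x) $ l else 0)
            - (if l = j then a $ i $ j * (a *v x) $ l else 0))"
      using False by (intro sum.cong refl) (simp add: x_def axis_def)
    also have "\<dots> = (a *v x) $ i - a $ i $ j * (a *v x) $ j"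
      by (simp add: sum_subtractf)
    also have "\<dots> = - 2 * (a $ i $ j * cnj (a $ i $ j))"
      unfolding ax by (simp add: zero ji)
    also have "\<dots> = of_real (- 2 * (cmod (a $ i $ j))\<^sup>2)"
      by (simp only: of_real_mult complex_norm_square) simp
    finally have "rank_one x \<bullet> a = - 2 * (cmod (a $ i $ j))\<^sup>2"
      by (simp add: Re_quadratic_form)
    then show ?thesis
      using a by (auto simp: pos_semidef_iff dest: spec[of _ x])
  qed (simp add: zero)
  then show ?thesis
    by (simp add: vec_eq_iff)
qed

text \<open>
  One step of the Cholesky decomposition: with \<open>v = a e\<^sub>k / \<surd>a\<^sub>k\<^sub>k\<close>, the quadratic form of
  \<open>a - vv\<^sup>*\<close> at \<open>y\<close> is that of \<open>a\<close> at \<open>y - t e\<^sub>k\<close>, where \<open>t = (a y)\<^sub>k / a\<^sub>k\<^sub>k\<close> completes the square.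
\<close>

lemma pos_semidef_Cholesky_step:
  assumes a: "pos_semidef a" and k: "a $ k $ k \<noteq> 0"
  obtains v where "pos_semidef (a - rank_one v)" "(a - rank_one v) $ k $ k = 0"
proof -
  define r where "r = Re (a $ k $ k)"
  have akk: "a $ k $ k = of_real r" and r: "r > 0"
    using pos_semidef_diagonal[OF a, of k] k unfolding r_def
    by (auto simp: less_le)
  have herm: "cnj (a $ i $ j) = a $ j $ i" for i j
    using a by (simp add: pos_semidef_iff hermitian_iff)
  define v :: "complex ^ 'a" where "v = (\<chi> i. a $ i $ k / of_real (sqrt r))"
  have rr: "complex_of_real (sqrt r) * complex_of_real (sqrt r) = of_real r"
    using r by (simp flip: of_real_mult)
  have kk: "(a - rank_one v) $ k $ k = 0"
    using r rr by (simp add: rank_one_def v_def akk)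
  have "0 \<le> rank_one y \<bullet> (a - rank_one v)" for y
  proof -
    define u where "u = (a *v y) $ k"
    define t where "t = u / of_real r"
    define z where "z = y - t *s axis k 1"
    have az: "(a *v z) $ i = (a *v y) $ i - t * a $ i $ k" for i
      by (simp add: z_def matrix_vector_mult_diff_distrib matrix_vector_mult_axis
          vector_scalar_commute)
    have azk: "(a *v z) $ k = 0"
      unfolding az using r by (simp add: t_def akk u_def)
    have cu: "(\<Sum>i\<in>UNIV. cnj (y $ i) * a $ i $ k) = cnj u"
      by (simp add: u_def matrix_vector_mult_def herm mult.commute)
    have "(\<Sum>i\<in>UNIV. cnj (z $ i) * (a *v z) $ i) = (\<Sum>i\<in>UNIV. cnj (y $ i) * (a *v z) $ i)"
      by (intro sum.cong refl) (use azk in \<open>auto simp: z_def axis_def\<close>)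
    also have "\<dots> = (\<Sum>i\<in>UNIV. cnj (y $ i) * (a *v y) $ i)
        - t * (\<Sum>i\<in>UNIV. cnj (y $ i) * a $ i $ k)"
      by (simp add: az algebra_simps sum_subtractf sum_distrib_left)
    also have "t * (\<Sum>i\<in>UNIV. cnj (y $ i) * a $ i $ k) = of_real ((cmod u)\<^sup>2 / r)"
      unfolding cu t_def of_real_divide complex_norm_square by simp
    finally have "rank_one z \<bullet> a = rank_one y \<bullet> a - (cmod u)\<^sup>2 / r"
      by (simp add: Re_quadratic_form)
    moreover have "(\<Sum>i\<in>UNIV. cnj (v $ i) * y $ i) = u / of_real (sqrt r)"
      by (simp add: v_def u_def herm matrix_vector_mult_def sum_divide_distrib)
    then have "rank_one y \<bullet> rank_one v = (cmod u)\<^sup>2 / r"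
      unfolding inner_rank_one_rank_one using r by (simp add: norm_divide power_divide)
    ultimately have "rank_one y \<bullet> (a - rank_one v) = rank_one z \<bullet> a"
      by (simp add: inner_diff_right)
    then show ?thesis
      using a by (simp add: pos_semidef_iff)
  qed
  then have "pos_semidef (a - rank_one v)"
    using a by (simp add: pos_semidef_iff hermitian_diff hermitian_rank_one)
  with kk show ?thesis
    by (rule that[rotated])
qed

text \<open>
  Peeling off rank-one matrices writes \<open>a\<close> as a sum of matrices \<open>vv\<^sup>*\<close>, each of which pairs
  nonnegatively with \<open>s\<close> by definition. The process stops because each step clears a diagonal
  entry and a vanishing diagonal entry stays zero: it can only decrease, and not below zero.
\<close>

lemma inner_pos_semidef_nonneg:
  assumes "pos_semidef a" and s: "pos_semidef s"
  shows "0 \<le> a \<bullet> s"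
  using assms(1)
proof (induction "card {k. a $ k $ k \<noteq> 0}" arbitrary: a rule: less_induct)
  case (less a)
  show ?case
  proof (cases "\<exists>k. a $ k $ k \<noteq> 0")
    case False
    then show ?thesis
      using pos_semidef_zero_diagonal[OF less.prems] by simp
  next
    case True
    then obtain k where k: "a $ k $ k \<noteq> 0" by blast
    obtain v where v: "pos_semidef (a - rank_one v)" "(a - rank_one v) $ k $ k = 0"
      using pos_semidef_Cholesky_step[OF less.prems k] .
    have stay: "(a - rank_one v) $ i $ i = 0" if "a $ i $ i = 0" for i
    proof -
      have "Re ((a - rank_one v) $ i $ i) = - (cmod (v $ i))\<^sup>2"
        by (simp add: rank_one_def that cmod_power2 flip: power2_eq_square)
      then show ?thesis
        using pos_semidef_diagonal[OF v(1), of i]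
        by (smt (verit) of_real_0 zero_le_power2)
    qed
    then have "{i. (a - rank_one v) $ i $ i \<noteq> 0} \<subset> {i. a $ i $ i \<noteq> 0}"
      using v(2) k by blast
    then have "0 \<le> (a - rank_one v) \<bullet> s"
      by (intro less.hyps v(1) psubset_card_mono) auto
    moreover have "0 \<le> rank_one v \<bullet> s"
      using s by (simp add: pos_semidef_iff)
    ultimately show ?thesis
      by (simp add: inner_diff_left)
  qed
qed

section \<open>The set of density matrices\<close>

lemma mem_density_matrices_iff:
  "a \<in> density_matrices \<longleftrightarrow> hermitian a \<and> (\<forall>x. 0 \<le> rank_one x \<bullet> a) \<and> mat 1 \<bullet> a = 1"
  unfolding density_matrices_def pos_semidef_iff
  by (auto simp: trace_hermitian)

lemma convex_density_matrices: "convex density_matrices"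
  by (rule convexI)
    (auto simp: mem_density_matrices_iff hermitian_add hermitian_scaleR inner_add_right
      simp flip: distrib_left)

text \<open>
  Boundedness comes from pairing \<open>\<rho>\<close> with the positive-semidefinite matrix \<open>\<parallel>\<rho>\<parallel>\<one> - \<rho>\<close>, which
  gives \<open>\<parallel>\<rho>\<parallel>\<^sup>2 \<le> \<parallel>\<rho>\<parallel> tr \<rho>\<close>.
\<close>

lemma compact_density_matrices: "compact (density_matrices :: 'n::finite cmat set)"
  unfolding compact_eq_bounded_closed
proof
  have "norm \<rho> \<le> 1" if "\<rho> \<in> density_matrices" for \<rho> :: "'n cmat"
  proof -
    have "hermitian (- \<rho>)" and \<rho>: "pos_semidef \<rho>" "mat 1 \<bullet> \<rho> = 1"
      using that hermitian_scaleR[of \<rho> "- 1"]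
      by (auto simp: mem_density_matrices_iff pos_semidef_iff)
    then have "0 \<le> \<rho> \<bullet> (- \<rho> + norm (- \<rho>) *\<^sub>R mat 1)"
      by (intro inner_pos_semidef_nonneg pos_semidef_add_norm)
    then have "norm \<rho> * norm \<rho> \<le> norm \<rho> * 1"
      using \<rho>(2) by (simp add: inner_diff_right inner_commute dot_square_norm power2_eq_square)
    then show ?thesis
      by (cases "\<rho> = 0") auto
  qed
  then show "bounded (density_matrices :: 'n cmat set)"
    by (auto simp: bounded_iff)
  have "density_matrices = (\<Inter>i j. {a :: 'n cmat. cnj (a $ i $ j) = a $ j $ i})
      \<inter> (\<Inter>x. {a. 0 \<le> rank_one x \<bullet> a}) \<inter> {a. mat 1 \<bullet> a = 1}"
    by (auto simp: mem_density_matrices_iff hermitian_iff)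
  also have "closed \<dots>"
    by (intro closed_Int closed_INT ballI closed_Collect_eq closed_Collect_le continuous_intros)
  finally show "closed (density_matrices :: 'n cmat set)" .
qed

section \<open>Operator systems and their states\<close>

lemma operator_system_add: "operator_system S \<Longrightarrow> s \<in> S \<Longrightarrow> t \<in> S \<Longrightarrow> s + t \<in> S"
  by (simp add: operator_system_def cmat.subspace_add)

lemma operator_system_scaleR: "operator_system S \<Longrightarrow> s \<in> S \<Longrightarrow> r *\<^sub>R s \<in> S"
  by (metis operator_system_def cmat.subspace_scale cscale_of_real)

lemma operator_system_mat_1: "operator_system S \<Longrightarrow> mat 1 \<in> S"
  by (simp add: operator_system_def)

lemma subspace_hermitian_part:
  assumes "operator_system S"
  shows "subspace (hermitian_part S)"
  using assms operator_system_scaleR[OF assms operator_system_mat_1[OF assms], of 0]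
  by (auto simp: subspace_def hermitian_part_def operator_system_add operator_system_scaleR
      hermitian_add hermitian_scaleR) (simp add: hermitian_iff)

text \<open>A hermitian \<open>h\<close> is the difference of the positive matrices \<open>h + \<parallel>h\<parallel>\<one>\<close> and \<open>\<parallel>h\<parallel>\<one>\<close>.\<close>

lemma state_real_on_hermitian:
  assumes S: "operator_system S" and f: "state_on S f" and h: "h \<in> S" "hermitian h"
  shows "Im (f h) = 0"
proof -
  have 1: "mat 1 \<in> S" "norm h *\<^sub>R mat 1 \<in> S"
    using S by (auto intro: operator_system_mat_1 operator_system_scaleR)
  then have "f (h + norm h *\<^sub>R mat 1) \<in> \<real>\<^sub>\<ge>\<^sub>0"
    using f h S pos_semidef_add_norm[OF h(2)] operator_system_add
    unfolding state_on_def by blast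
  moreover have "f (h + norm h *\<^sub>R mat 1) = f h + of_real (norm h)"
    using f h 1 unfolding state_on_def
    by (metis cscale_of_real mult.right_neutral)
  ultimately show ?thesis
    by (simp add: complex_nonneg_Reals_iff)
qed

text \<open>
  For \<open>d = a - a\<^sup>*\<close>, the matrix \<open>\<i> d\<close> is a hermitian element of \<open>S\<close> and the imaginary part of
  \<open>f\<^sub>a\<close> on it is \<open>a \<bullet> d = (d \<bullet> d) / 2\<close>.
\<close>

lemma hermitian_if_state:
  assumes S: "operator_system S" and a: "a \<in> S" and f: "state_on S (hs_inner a)"
  shows "hermitian a"
proof -
  define d where "d = a - conj_transpose a"
  have "d \<in> S"
    using S a by (auto simp: d_def operator_system_def intro: cmat.subspace_diff)
  then have "cscale \<i> d \<in> S"
    using S by (simp add: operator_system_def cmat.subspace_scale)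
  moreover have "hermitian (cscale \<i> d)"
    by (simp add: hermitian_iff d_def cscale_def algebra_simps)
  ultimately have "Im (hs_inner a (cscale \<i> d)) = 0"
    using state_real_on_hermitian[OF S f] by blast
  then have ad: "a \<bullet> d = 0"
    by (simp add: hs_inner_cscale_right flip: Re_hs_inner)
  have "conj_transpose d = - d"
    by (simp add: d_def vec_eq_iff)
  then have "conj_transpose a \<bullet> d = - (a \<bullet> d)"
    by (metis inner_conj_transpose inner_minus_right minus_minus)
  with ad have "d \<bullet> d = 0"
    by (simp add: d_def inner_diff_left)
  then show ?thesis
    by (simp add: d_def hermitian_def)
qed

lemma orth_proj_hermitian_part:
  assumes "operator_system S" "hermitian a"
  shows "orth_proj (hermitian_part S) a \<in> hermitian_part S"
    "\<And>x. x \<in> hermitian_part S \<Longrightarrow> hs_inner x (a - orth_proj (hermitian_part S) a) = 0"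
    "\<And>p. p \<in> hermitian_part S \<Longrightarrow> (\<And>x. x \<in> hermitian_part S \<Longrightarrow> hs_inner x (a - p) = 0) \<Longrightarrow>
      orth_proj (hermitian_part S) a = p"
proof -
  have ex1: "\<exists>!p. p \<in> hermitian_part S \<and> (\<forall>x\<in>hermitian_part S. hs_inner x (a - p) = 0)"
    by (rule orth_proj_ex1) (use assms subspace_hermitian_part in \<open>auto simp: hermitian_part_def\<close>)
  show "orth_proj (hermitian_part S) a \<in> hermitian_part S"
    "\<And>x. x \<in> hermitian_part S \<Longrightarrow> hs_inner x (a - orth_proj (hermitian_part S) a) = 0"
    using theI'[OF ex1] unfolding orth_proj_def by blast+
  show "orth_proj (hermitian_part S) a = p"
    if "p \<in> hermitian_part S" "\<And>x. x \<in> hermitian_part S \<Longrightarrow> hs_inner x (a - p) = 0" for p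
    unfolding orth_proj_def by (rule the1_equality[OF ex1]) (use that in blast)
qed

lemma orth_proj_density_matrix_in_state_space:
  assumes S: "operator_system S" and \<rho>: "\<rho> \<in> density_matrices"
  shows "orth_proj (hermitian_part S) \<rho> \<in> state_space S"
proof -
  define p where "p = orth_proj (hermitian_part S) \<rho>"
  have h\<rho>: "hermitian \<rho>" "pos_semidef \<rho>" "mat 1 \<bullet> \<rho> = 1"
    using \<rho> by (auto simp: mem_density_matrices_iff pos_semidef_iff)
  have p: "p \<in> S" "hermitian p"
    using orth_proj_hermitian_part(1)[OF S h\<rho>(1)] by (auto simp: p_def hermitian_part_def)
  have eq: "hs_inner p s = of_real (\<rho> \<bullet> s)" if s: "s \<in> S" "hermitian s" for s
  proof -
    have "s \<bullet> (\<rho> - p) = 0"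
      using orth_proj_hermitian_part(2)[OF S h\<rho>(1), of s] s
      by (simp add: p_def hermitian_part_def flip: Re_hs_inner)
    then show ?thesis
      using s p by (simp add: hs_inner_hermitian inner_diff_right inner_commute)
  qed
  have "state_on S (hs_inner p)"
    unfolding state_on_def
  proof (intro conjI ballI allI impI)
    fix s assume s: "s \<in> S" "pos_semidef s"
    then have "hs_inner p s = of_real (\<rho> \<bullet> s)"
      using eq by (simp add: pos_semidef_iff)
    then show "hs_inner p s \<in> \<real>\<^sub>\<ge>\<^sub>0"
      using inner_pos_semidef_nonneg[OF h\<rho>(2) s(2)] by simp
  next
    show "hs_inner p (mat 1) = 1"
      using eq[OF operator_system_mat_1[OF S] hermitian_mat_1] h\<rho>(3)
      by (simp add: inner_commute)
  qed (simp_all add: hs_inner_add_right hs_inner_cscale_right)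
  then show ?thesis
    using p by (simp add: state_space_def p_def)
qed

lemma state_space_subset_orth_proj_density_matrices:
  assumes S: "operator_system S" and a: "a \<in> state_space S"
  shows "a \<in> orth_proj (hermitian_part S) ` density_matrices"
proof -
  have aS: "a \<in> S" and f: "state_on S (hs_inner a)"
    using a by (auto simp: state_space_def)
  have ha: "hermitian a"
    by (rule hermitian_if_state[OF S aS f])
  let ?X = "hermitian_part S"
  define C where "C = {\<rho> + w | \<rho> w. \<rho> \<in> density_matrices \<and> w \<in> ?X\<^sup>\<bottom>}"
  have subX: "subspace ?X"
    by (rule subspace_hermitian_part[OF S])
  have "convex C"
    using convex_sums[OF convex_density_matrices subspace_imp_convex[OF subspace_orthogonal_comp],
        of ?X]
    by (rule back_subst[of convex]) (auto simp: C_def)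
  moreover have "closed C"
    using compact_closed_sums[OF compact_density_matrices
        closed_subspace[OF subspace_orthogonal_comp], of ?X]
    by (rule back_subst[of closed]) (auto simp: C_def)
  moreover have "a \<in> C"
  proof (rule ccontr)
    assume "a \<notin> C"
    then obtain h b where hb: "h \<bullet> a < b" "\<And>c. c \<in> C \<Longrightarrow> b < h \<bullet> c"
      using separating_hyperplane_closed_point[OF \<open>convex C\<close> \<open>closed C\<close>] by blast
    have pure: "rank_one x \<in> density_matrices" if "norm x = 1" for x :: "complex ^ 'a"
      using that
      by (simp add: mem_density_matrices_iff hermitian_rank_one inner_mat_1_rank_one
          inner_rank_one_rank_one)
    define e :: "'a cmat" where "e = rank_one (axis undefined 1)"
    have e: "e \<in> density_matrices"
      unfolding e_def by (rule pure) simp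
    have "h \<bullet> w = 0" if w: "w \<in> ?X\<^sup>\<bottom>" for w
    proof (rule ccontr)
      assume ne: "h \<bullet> w \<noteq> 0"
      \<comment> \<open>Moving from \<open>e\<close> along \<open>w\<close> stays in \<open>C\<close>; this \<open>t\<close> is where the line reaches \<open>h \<bullet> c = b\<close>.\<close>
      define t where "t = (b - h \<bullet> e) / (h \<bullet> w)"
      have "e + t *\<^sub>R w \<in> C"
        using e w subspace_scale[OF subspace_orthogonal_comp] unfolding C_def by blast
      then have "b < h \<bullet> (e + t *\<^sub>R w)"
        by (rule hb)
      then show False
        using ne by (simp add: t_def inner_add_right)
    qed
    then have "h \<in> ?X\<^sup>\<bottom>\<^sup>\<bottom>"
      by (auto simp: orthogonal_comp_def orthogonal_def inner_commute)
    then have h: "h \<in> S" "hermitian h"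
      using orthogonal_comp_self[OF subX] by (auto simp: hermitian_part_def)
    have lower: "b \<le> h \<bullet> \<rho>" if "\<rho> \<in> density_matrices" for \<rho>
    proof -
      have "\<rho> + 0 \<in> C"
        using that subspace_0[OF subspace_orthogonal_comp] unfolding C_def by blast
      then show ?thesis
        using hb(2) by fastforce
    qed
    define k where "k = h + (- b) *\<^sub>R mat 1"
    have kS: "k \<in> S"
      unfolding k_def using S h
      by (intro operator_system_add operator_system_scaleR operator_system_mat_1)
    have hk: "hermitian k"
      unfolding k_def by (intro hermitian_add hermitian_scaleR hermitian_mat_1 h)
    have "0 \<le> rank_one x \<bullet> k" for x
    proof (cases "x = 0")
      case True
      then have "rank_one x = 0"
        by (simp add: rank_one_def vec_eq_iff)
      then show ?thesis by simp
    next
      case False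
      define y where "y = (1 / norm x) *\<^sub>R x"
      have "norm y = 1"
        using False by (simp add: y_def)
      then have "b \<le> h \<bullet> rank_one y"
        by (intro lower pure)
      moreover have "rank_one x = (norm x)\<^sup>2 *\<^sub>R rank_one y"
        using False by (simp add: rank_one_def y_def vec_eq_iff power2_eq_square
            scaleR_conv_of_real[where 'a=complex])
      moreover have "rank_one y \<bullet> mat 1 = 1"
        by (simp add: inner_commute[of "rank_one y"] inner_mat_1_rank_one \<open>norm y = 1\<close>)
      ultimately show ?thesis
        by (simp add: k_def inner_diff_right inner_commute)
    qed
    then have "pos_semidef k"
      using hk by (simp add: pos_semidef_iff)
    then have "hs_inner a k \<in> \<real>\<^sub>\<ge>\<^sub>0"
      using f kS unfolding state_on_def by blast
    then have "0 \<le> a \<bullet> k"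
      by (simp add: hs_inner_hermitian ha hk)
    moreover have "hs_inner a (mat 1) = 1"
      using f by (simp add: state_on_def)
    then have "a \<bullet> mat 1 = 1"
      by (simp flip: Re_hs_inner)
    ultimately show False
      using hb(1) by (simp add: k_def inner_diff_right inner_commute)
  qed
  ultimately obtain \<rho> w where \<rho>: "a = \<rho> + w" "\<rho> \<in> density_matrices" "w \<in> ?X\<^sup>\<bottom>"
    by (auto simp: C_def)
  have h\<rho>: "hermitian \<rho>"
    using \<rho>(2) by (simp add: mem_density_matrices_iff)
  have "orth_proj ?X \<rho> = a"
  proof (rule orth_proj_hermitian_part(3)[OF S h\<rho>])
    show "a \<in> ?X"
      using aS ha by (simp add: hermitian_part_def)
    fix x assume x: "x \<in> ?X"
    then have "x \<bullet> (\<rho> - a) = 0"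
      using \<rho> by (auto simp: orthogonal_comp_def orthogonal_def inner_commute)
    then show "hs_inner x (\<rho> - a) = 0"
      using x by (simp add: hs_inner_hermitian hermitian_part_def hermitian_diff h\<rho> ha)
  qed
  then show ?thesis
    using \<rho>(2) by blast
qed

theorem theorem6p2:
  fixes S :: "(complex ^ 'n ^ 'n) set"
  assumes "operator_system S"
  shows "state_space S = orth_proj (hermitian_part S) ` density_matrices"
  using state_space_subset_orth_proj_density_matrices[OF assms]
    orth_proj_density_matrix_in_state_space[OF assms]
  by blast

end
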